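(* $MC(H_3)=5$, where $H_3$ is the finite Coxeter group with generators $s_1,s_2,s_3$ and relations $s_i^2=1$, $(s_1s_2)^5=(s_2s_3)^3=(s_1s_3)^2=1$.
   Context: Let $(W,S)$ be a finite Coxeter system with length function $\ell$, and let $R=\bigcup_{w\in W,\,s\in S}\{wsw^{-1}\}$ be its set of reflections. For $w\in W$ set $N(w)=\{t\in R\mid \ell(wt)<\ell(w)\}$. A subset $Y\subset W$ is inversion complete if $\bigcup_{w\in Y}N(w)=R$; it is minimal inversion complete if it is inversion complete and no proper subset of $Y$ is inversion complete. If $(W,S)$ is of type $T$, $MC(T)$ denotes the maximal cardinality of a minimal inversion complete subset of $W$. *)

theory Defs
  imports "HOL-Algebra.Algebra"
begin

section \<open>Groups given by generators and relations\<close>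

text \<open>
  A word is a list of signed generator names: \<open>(i, True)\<close> stands for the generator \<open>i\<close>
  and \<open>(i, False)\<close> for its formal inverse.
\<close>

type_synonym 'i signed_word = "('i \<times> bool) list"

text \<open>
  Two words are related if one is obtained from the other by inserting and deleting adjacent
  pairs of mutually inverse letters and relators from \<open>R\<close>, that is, if they agree in
  the free group on \<open>I\<close> modulo the normal closure of \<open>R\<close>.
\<close>

inductive pres_eq :: "'i set \<Rightarrow> 'i signed_word set \<Rightarrow> 'i signed_word \<Rightarrow> 'i signed_word \<Rightarrow> bool"
  for I :: "'i set" and R :: "'i signed_word set"
where
  pres_refl: "pres_eq I R u u"
| pres_sym: "pres_eq I R u v \<Longrightarrow> pres_eq I R v u"
| pres_trans: "pres_eq I R u v \<Longrightarrow> pres_eq I R v w \<Longrightarrow> pres_eq I R u w"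
| pres_cancel: "i \<in> I \<Longrightarrow> pres_eq I R (u @ [(i, b), (i, \<not> b)] @ v) (u @ v)"
| pres_relator: "r \<in> R \<Longrightarrow> pres_eq I R (u @ r @ v) (u @ v)"

definition letter_value :: "('a, 'm) monoid_scheme \<Rightarrow> ('i \<Rightarrow> 'a) \<Rightarrow> 'i \<times> bool \<Rightarrow> 'a" where
  "letter_value G s x = (if snd x then s (fst x) else inv\<^bsub>G\<^esub> s (fst x))"

definition list_product :: "('a, 'm) monoid_scheme \<Rightarrow> 'a list \<Rightarrow> 'a" where
  "list_product G xs = foldr (\<lambda>x y. x \<otimes>\<^bsub>G\<^esub> y) xs \<one>\<^bsub>G\<^esub>"

definition word_value :: "('a, 'm) monoid_scheme \<Rightarrow> ('i \<Rightarrow> 'a) \<Rightarrow> 'i signed_word \<Rightarrow> 'a" where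
  "word_value G s u = list_product G (map (letter_value G s) u)"

text \<open>
  \<open>G\<close> has the presentation with generators \<open>s i\<close> (\<open>i \<in> I\<close>) and relators \<open>R\<close>:
  the \<open>s i\<close> generate \<open>G\<close>, and the words that evaluate to the unit are exactly those that are
  trivial modulo the relators.
\<close>

definition group_presentation ::
  "('a, 'm) monoid_scheme \<Rightarrow> 'i set \<Rightarrow> ('i \<Rightarrow> 'a) \<Rightarrow> 'i signed_word set \<Rightarrow> bool"
where
  "group_presentation G I s R \<longleftrightarrow>
     group G \<and> s ` I \<subseteq> carrier G \<and> generate G (s ` I) = carrier G \<and>
     (\<forall>u \<in> lists (I \<times> UNIV). word_value G s u = \<one>\<^bsub>G\<^esub> \<longleftrightarrow> pres_eq I R u [])"


section \<open>Coxeter systems\<close>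

text \<open>
  The entry \<open>0\<close> encodes infinity: the relator \<open>(s i s j)^0\<close> is the empty word, which imposes
  no relation.
\<close>

definition coxeter_matrix :: "'i set \<Rightarrow> ('i \<Rightarrow> 'i \<Rightarrow> nat) \<Rightarrow> bool" where
  "coxeter_matrix I m \<longleftrightarrow>
     (\<forall>i\<in>I. \<forall>j\<in>I. m i j = m j i \<and> (m i j = 1 \<longleftrightarrow> i = j))"

definition coxeter_relators :: "'i set \<Rightarrow> ('i \<Rightarrow> 'i \<Rightarrow> nat) \<Rightarrow> 'i signed_word set" where
  "coxeter_relators I m =
     {concat (replicate (m i j) [(i, True), (j, True)]) |i j. i \<in> I \<and> j \<in> I}"

text \<open>\<open>(W, s ` I)\<close> is a Coxeter system of the type given by the Coxeter matrix \<open>m\<close>.\<close>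

definition coxeter_system ::
  "('a, 'm) monoid_scheme \<Rightarrow> 'i set \<Rightarrow> ('i \<Rightarrow> 'a) \<Rightarrow> ('i \<Rightarrow> 'i \<Rightarrow> nat) \<Rightarrow> bool"
where
  "coxeter_system W I s m \<longleftrightarrow>
     finite I \<and> coxeter_matrix I m \<and> group_presentation W I s (coxeter_relators I m)"

definition H3_matrix :: "nat \<Rightarrow> nat \<Rightarrow> nat" where
  "H3_matrix i j =
     (if i = j then 1
      else if {i, j} = {1, 2} then 5
      else if {i, j} = {2, 3} then 3
      else 2)"


section \<open>Inversion complete sets\<close>

text \<open>
  Generators of a Coxeter system are involutions, so words without inverse letters suffice for
  the length function.
\<close>

definition cox_length :: "('a, 'm) monoid_scheme \<Rightarrow> 'a set \<Rightarrow> 'a \<Rightarrow> nat" where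
  "cox_length W S w = (LEAST n. \<exists>xs \<in> lists S. length xs = n \<and> list_product W xs = w)"

definition reflections :: "('a, 'm) monoid_scheme \<Rightarrow> 'a set \<Rightarrow> 'a set" where
  "reflections W S = {w \<otimes>\<^bsub>W\<^esub> s \<otimes>\<^bsub>W\<^esub> inv\<^bsub>W\<^esub> w |w s. w \<in> carrier W \<and> s \<in> S}"

definition inversions :: "('a, 'm) monoid_scheme \<Rightarrow> 'a set \<Rightarrow> 'a \<Rightarrow> 'a set" where
  "inversions W S w =
     {t \<in> reflections W S. cox_length W S (w \<otimes>\<^bsub>W\<^esub> t) < cox_length W S w}"

definition inversion_complete :: "('a, 'm) monoid_scheme \<Rightarrow> 'a set \<Rightarrow> 'a set \<Rightarrow> bool" where
  "inversion_complete W S Y \<longleftrightarrow>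
     Y \<subseteq> carrier W \<and> (\<Union>w\<in>Y. inversions W S w) = reflections W S"

definition minimal_inversion_complete ::
  "('a, 'm) monoid_scheme \<Rightarrow> 'a set \<Rightarrow> 'a set \<Rightarrow> bool"
where
  "minimal_inversion_complete W S Y \<longleftrightarrow>
     inversion_complete W S Y \<and> (\<forall>Z. Z \<subset> Y \<longrightarrow> \<not> inversion_complete W S Z)"

definition MC :: "('a, 'm) monoid_scheme \<Rightarrow> 'a set \<Rightarrow> nat" where
  "MC W S = Max (card ` {Y. minimal_inversion_complete W S Y})"


section \<open>Existence of Coxeter systems\<close>

text \<open>
  Every Coxeter matrix is the type of a Coxeter system, namely of the group of words modulo
  \<^const>\<open>pres_eq\<close>; so the hypothesis \<^const>\<open>coxeter_system\<close> is never vacuous.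
\<close>

definition word_class :: "'i set \<Rightarrow> 'i signed_word set \<Rightarrow> 'i signed_word \<Rightarrow> 'i signed_word set" where
  "word_class I R u = {v \<in> lists (I \<times> UNIV). pres_eq I R u v}"

definition presented_group :: "'i set \<Rightarrow> 'i signed_word set \<Rightarrow> 'i signed_word set monoid" where
  "presented_group I R =
     \<lparr>carrier = word_class I R ` lists (I \<times> UNIV),
      monoid.mult = (\<lambda>A B. {w \<in> lists (I \<times> UNIV). \<exists>u\<in>A. \<exists>v\<in>B. pres_eq I R (u @ v) w}),
      monoid.one = word_class I R []\<rparr>"

lemma pres_eq_context: "pres_eq I R u v \<Longrightarrow> pres_eq I R (p @ u @ q) (p @ v @ q)"
proof (induction rule: pres_eq.induct)
  case (pres_cancel i u b v)
  then show ?case using pres_eq.pres_cancel[of i I R "p @ u" b "v @ q"] by simp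
next
  case (pres_relator r u v)
  then show ?case using pres_eq.pres_relator[of r R I "p @ u" "v @ q"] by simp
qed (blast intro: pres_eq.pres_refl pres_eq.pres_sym pres_eq.pres_trans)+

lemma pres_eq_append:
  assumes "pres_eq I R u u'" "pres_eq I R v v'"
  shows "pres_eq I R (u @ v) (u' @ v')"
  using pres_eq_context[OF assms(1), of "[]" v] pres_eq_context[OF assms(2), of u' "[]"]
  by (auto intro: pres_trans)

lemma word_class_eq_iff:
  assumes "u \<in> lists (I \<times> UNIV)" "v \<in> lists (I \<times> UNIV)"
  shows "word_class I R u = word_class I R v \<longleftrightarrow> pres_eq I R u v"
proof
  assume "word_class I R u = word_class I R v"
  moreover have "v \<in> word_class I R v"
    using assms by (simp add: word_class_def pres_refl)
  ultimately show "pres_eq I R u v"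
    by (auto simp: word_class_def)
next
  assume "pres_eq I R u v"
  then show "word_class I R u = word_class I R v"
    unfolding word_class_def by (blast intro: pres_sym pres_trans)
qed

lemma presented_mult:
  assumes "u \<in> lists (I \<times> UNIV)" "v \<in> lists (I \<times> UNIV)"
  shows "word_class I R u \<otimes>\<^bsub>presented_group I R\<^esub> word_class I R v = word_class I R (u @ v)"
proof -
  have "pres_eq I R (u @ v) w"
    if "pres_eq I R u u'" "pres_eq I R v v'" "pres_eq I R (u' @ v') w" for u' v' w
    using pres_eq_append[OF that(1,2)] that(3) by (rule pres_trans)
  moreover have "u \<in> word_class I R u" "v \<in> word_class I R v"
    using assms by (simp_all add: word_class_def pres_refl)
  ultimately show ?thesis
    by (auto simp: presented_group_def word_class_def)
qed

lemma presented_inverse: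
  assumes "u \<in> lists (I \<times> UNIV)"
  shows "pres_eq I R (rev (map (apsnd Not) u) @ u) []"
  using assms
proof (induction u)
  case Nil
  then show ?case by (simp add: pres_refl)
next
  case (Cons x u)
  obtain i b where x: "x = (i, b)" by (cases x)
  let ?u = "rev (map (apsnd Not) u)"
  have "pres_eq I R (?u @ [(i, \<not> b), (i, \<not> \<not> b)] @ u) (?u @ u)"
    using Cons.hyps x by (intro pres_cancel) auto
  moreover have "pres_eq I R (?u @ u) []"
    using Cons by simp
  ultimately show ?case
    by (auto simp: x intro: pres_trans)
qed

lemma group_presented_group: "group (presented_group I R)"
proof (rule groupI)
  let ?G = "presented_group I R"
  have carrier: "carrier ?G = word_class I R ` lists (I \<times> UNIV)"
    and one: "\<one>\<^bsub>?G\<^esub> = word_class I R []"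
    by (simp_all add: presented_group_def)
  show "\<one>\<^bsub>?G\<^esub> \<in> carrier ?G"
    unfolding carrier one by blast
  fix x y z
  assume "x \<in> carrier ?G"
  then obtain u where u: "u \<in> lists (I \<times> UNIV)" "x = word_class I R u"
    unfolding carrier by blast
  show "\<one>\<^bsub>?G\<^esub> \<otimes>\<^bsub>?G\<^esub> x = x"
    using presented_mult[of "[]" I u R] u by (simp add: one)
  let ?v = "rev (map (apsnd Not) u)"
  have v: "?v \<in> lists (I \<times> UNIV)"
    using u(1) by (fastforce simp: in_lists_conv_set)
  have "word_class I R ?v \<otimes>\<^bsub>?G\<^esub> x = \<one>\<^bsub>?G\<^esub>"
    unfolding u(2) presented_mult[OF v u(1)] one
    using presented_inverse[OF u(1)] u(1) v by (subst word_class_eq_iff) auto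
  then show "\<exists>y\<in>carrier ?G. y \<otimes>\<^bsub>?G\<^esub> x = \<one>\<^bsub>?G\<^esub>"
    unfolding carrier using v by blast
  assume "y \<in> carrier ?G"
  then obtain v where v: "v \<in> lists (I \<times> UNIV)" "y = word_class I R v"
    unfolding carrier by blast
  have uv: "u @ v \<in> lists (I \<times> UNIV)"
    using u v by auto
  show "x \<otimes>\<^bsub>?G\<^esub> y \<in> carrier ?G"
    using uv u v by (simp add: presented_mult carrier)
  assume "z \<in> carrier ?G"
  then obtain w where w: "w \<in> lists (I \<times> UNIV)" "z = word_class I R w"
    unfolding carrier by blast
  have vw: "v @ w \<in> lists (I \<times> UNIV)"
    using v w by auto
  show "x \<otimes>\<^bsub>?G\<^esub> y \<otimes>\<^bsub>?G\<^esub> z = x \<otimes>\<^bsub>?G\<^esub> (y \<otimes>\<^bsub>?G\<^esub> z)"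
    unfolding u(2) v(2) w(2)
    by (simp only: presented_mult u(1) v(1) w(1) uv vw append_assoc)
qed

lemma presented_group_word_value:
  assumes "u \<in> lists (I \<times> UNIV)"
  shows "word_value (presented_group I R) (\<lambda>i. word_class I R [(i, True)]) u = word_class I R u"
  using assms
proof (induction u)
  case Nil
  then show ?case by (simp add: word_value_def list_product_def presented_group_def)
next
  case (Cons x u)
  let ?G = "presented_group I R" and ?s = "\<lambda>i. word_class I R [(i, True)]"
  interpret group ?G by (rule group_presented_group)
  obtain i b where x: "x = (i, b)" by (cases x)
  have i: "i \<in> I" using Cons.hyps x by auto
  have carrier: "word_class I R [(i, c)] \<in> carrier ?G" for c
    using i by (auto simp: presented_group_def)
  have "word_class I R [(i, False)] \<otimes>\<^bsub>?G\<^esub> ?s i = word_class I R [(i, False), (i, True)]"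
    using i by (simp add: presented_mult)
  also have "\<dots> = \<one>\<^bsub>?G\<^esub>"
    using i pres_cancel[OF i, of R "[]" False "[]"]
    by (simp add: presented_group_def word_class_eq_iff)
  finally have "inv\<^bsub>?G\<^esub> ?s i = word_class I R [(i, False)]"
    using carrier by (intro inv_equality) auto
  then have "letter_value ?G ?s x = word_class I R [x]"
    by (cases b) (simp_all add: letter_value_def x)
  then show ?case
    using Cons presented_mult[of "[x]" I u R]
    by (simp add: word_value_def list_product_def)
qed

lemma presented_group_presentation:
  "group_presentation (presented_group I R) I (\<lambda>i. word_class I R [(i, True)]) R"
proof -
  let ?G = "presented_group I R" and ?s = "\<lambda>i. word_class I R [(i, True)]"
  interpret group ?G by (rule group_presented_group)
  have sub: "?s ` I \<subseteq> carrier ?G"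
    by (auto simp: presented_group_def)
  have "word_value ?G ?s u \<in> generate ?G (?s ` I)" if "u \<in> lists (I \<times> UNIV)" for u
    using that
    by (induction u)
      (auto simp: word_value_def list_product_def letter_value_def
        intro!: generate.one generate.eng intro: generate.incl generate.inv)
  then have "carrier ?G \<subseteq> generate ?G (?s ` I)"
    using presented_group_word_value by (fastforce simp: presented_group_def)
  then have "generate ?G (?s ` I) = carrier ?G"
    using generate_incl[OF sub] by blast
  moreover have "word_value ?G ?s u = \<one>\<^bsub>?G\<^esub> \<longleftrightarrow> pres_eq I R u []"
    if "u \<in> lists (I \<times> UNIV)" for u
  proof -
    have "\<one>\<^bsub>?G\<^esub> = word_class I R []"
      by (simp add: presented_group_def)
    then show ?thesis
      using that by (simp add: presented_group_word_value word_class_eq_iff)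
  qed
  ultimately show ?thesis
    unfolding group_presentation_def using sub is_group by blast
qed

lemma coxeter_system_exists:
  assumes "finite I" "coxeter_matrix I m"
  shows "coxeter_system (presented_group I (coxeter_relators I m)) I
           (\<lambda>i. word_class I (coxeter_relators I m) [(i, True)]) m"
  using assms presented_group_presentation by (auto simp: coxeter_system_def)

lemma coxeter_matrix_H3: "coxeter_matrix I H3_matrix"
  by (auto simp: coxeter_matrix_def H3_matrix_def insert_commute)

end

theory Submission
  imports Defs
begin

text \<open>
  An element \<open>w\<close> is determined by the set of the 15 positive roots that it makes negative, and these
  roots correspond to the reflections in such a way that this set becomes \<open>N(w)\<close>. In a minimal
  inversion complete set \<open>Y\<close> each element has a private reflection, one that no other element of
  \<open>Y\<close> inverts. A search over the 120 sets \<open>N(w)\<close> shows that only two sets of at least six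
  reflections consist of private reflections of some family, and that the elements of such a family
  never invert the reflection in the highest root; so a family of this kind is not complete.
\<close>

section \<open>Inversion vectors\<close>

text \<open>
  The roots are numbered from 0 to 14, where root \<open>i - 1\<close> is the simple root of the generator \<open>i\<close>
  and root 14 is the highest one. If entry \<open>k\<close> of \<open>v\<close> says whether \<open>w\<close> makes root \<open>k\<close> negative, then
  \<^term>\<open>step i v\<close> says this of \<open>w s\<^sub>i\<close>.
\<close>

fun step :: "nat \<Rightarrow> bool list \<Rightarrow> bool list" where
  "step i [a0,a1,a2,a3,a4,a5,a6,a7,a8,a9,a10,a11,a12,a13,a14] =
    (if i = 1 then [\<not> a0,a4,a2,a6,a1,a8,a3,a9,a5,a7,a12,a13,a10,a11,a14]
     else if i = 2 then [a3,\<not> a1,a5,a0,a6,a2,a4,a7,a10,a11,a8,a9,a12,a14,a13]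
     else [a0,a5,\<not> a2,a7,a8,a1,a9,a3,a4,a6,a11,a10,a13,a12,a14])"
| "step i v = v"

text \<open>A generator permutes the positive roots other than its own simple root, which has index
  \<open>i - 1\<close> and is negated; \<open>root_perm\<close> records this action up to sign. By
  \<open>conj_r\<close>, conjugation permutes the reflections in the same way.\<close>

definition root_perm :: "nat \<Rightarrow> nat list" where
  "root_perm i =
    (if i = 1 then [0,4,2,6,1,8,3,9,5,7,12,13,10,11,14]
     else if i = 2 then [3,1,5,0,6,2,4,7,10,11,8,9,12,14,13]
     else [0,5,2,7,8,1,9,3,4,6,11,10,13,12,14])"

definition vec :: "nat list \<Rightarrow> bool list" where
  "vec xs = fold step xs (replicate 15 False)"

lemma list_15_cases:
  assumes "length v = 15"
  obtains a0 a1 a2 a3 a4 a5 a6 a7 a8 a9 a10 a11 a12 a13 a14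
  where "v = [a0,a1,a2,a3,a4,a5,a6,a7,a8,a9,a10,a11,a12,a13,a14]"
  using assms by (auto simp: length_Suc_conv numeral_eq_Suc)

lemma less_15_iff:
  "k < (15::nat) \<longleftrightarrow> k \<in> {0,1,2,3,4,5,6,7,8,9,10,11,12,13,14}"
  by (auto simp: less_Suc_eq numeral_eq_Suc)

lemma length_step [simp]: "length (step i v) = length v"
  by (cases "(i, v)" rule: step.cases) auto

lemma length_fold_step [simp]: "length (fold step xs v) = length v"
  by (induction xs arbitrary: v) auto

lemma length_vec [simp]: "length (vec xs) = 15"
  by (simp add: vec_def)

lemma step_involution: "step i (step i v) = v"
  by (cases "(i, v)" rule: step.cases) auto

lemma step_other_length: "length v \<noteq> 15 \<Longrightarrow> step i v = v"
  by (cases "(i, v)" rule: step.cases) auto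

lemma fold_step_rev: "fold step xs (fold step (rev xs) v) = v"
  by (induction xs arbitrary: v) (simp_all add: step_involution)

lemma nth_step:
  assumes "length v = 15" "k < 15" "i \<in> {1,2,3}"
  shows "step i v ! k \<longleftrightarrow> (if k = i - 1 then \<not> v ! k else v ! (root_perm i ! k))"
proof -
  from assms(1) obtain a0 a1 a2 a3 a4 a5 a6 a7 a8 a9 a10 a11 a12 a13 a14
    where v: "v = [a0,a1,a2,a3,a4,a5,a6,a7,a8,a9,a10,a11,a12,a13,a14]"
    by (rule list_15_cases)
  show ?thesis
    using assms(2,3) unfolding v less_15_iff root_perm_def
    by (elim insertE emptyE) (simp_all)
qed

lemma root_perm_less:
  assumes "k < 15"
  shows "root_perm i ! k < 15"
  using assms unfolding less_15_iff root_perm_def by (elim insertE emptyE) simp_all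

text \<open>On a vector of fifteen indeterminate entries each of the nine relators computes to the
  identity, so \<open>step\<close> yields an action of the group. Vectors of any other length are
  fixed by the default clause of \<open>step\<close>.\<close>

lemma fold_step_relator:
  assumes "i \<in> {1,2,3}" "j \<in> {1,2,3}"
  shows "fold step (concat (replicate (H3_matrix i j) [i,j])) v = v"
proof (cases "length v = 15")
  case True
  then obtain a0 a1 a2 a3 a4 a5 a6 a7 a8 a9 a10 a11 a12 a13 a14
    where "v = [a0,a1,a2,a3,a4,a5,a6,a7,a8,a9,a10,a11,a12,a13,a14]"
    by (rule list_15_cases)
  moreover have "H3_matrix 1 1 = 1" "H3_matrix 1 2 = 5" "H3_matrix 1 3 = 2"
    "H3_matrix 2 1 = 5" "H3_matrix 2 2 = 1" "H3_matrix 2 3 = 3"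
    "H3_matrix 3 1 = 2" "H3_matrix 3 2 = 3" "H3_matrix 3 3 = 1"
    by (simp_all add: H3_matrix_def doubleton_eq_iff)
  ultimately show ?thesis
    using assms by (elim insertE emptyE) (simp_all add: numeral_eq_Suc)
next
  case False
  then have "fold step xs v = v" for xs
    by (induction xs) (simp_all add: step_other_length)
  then show ?thesis .
qed

text \<open>Signs are dropped because \<open>step i\<close> is an involution: a letter and its
  formal inverse act alike.\<close>

lemma fold_step_pres_eq:
  assumes "pres_eq {1,2,3} (coxeter_relators {1,2,3} H3_matrix) u u'"
  shows "fold step (map fst u) v = fold step (map fst u') v"
  using assms
proof (induction arbitrary: v rule: pres_eq.induct)
  case (pres_cancel i u b w)
  then show ?case by (simp add: step_involution)
next
  case (pres_relator r u w)
  then obtain i j where ij: "i \<in> {1,2,3}" "j \<in> {1,2,3}"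
    and r: "r = concat (replicate (H3_matrix i j) [(i, True), (j, True)])"
    unfolding coxeter_relators_def by blast
  have "map fst r = concat (replicate (H3_matrix i j) [i,j])"
    by (simp add: r map_concat)
  then show ?case
    using fold_step_relator[OF ij] by simp
qed auto

section \<open>The reflections as palindromic words\<close>

definition refl_words :: "nat list list" where
  "refl_words =
    [[1], [2], [3], [2,1,2], [1,2,1], [3,2,3], [1,2,1,2,1], [3,2,1,2,3], [3,1,2,1,3],
     [3,1,2,1,2,1,3], [2,3,1,2,1,3,2], [2,3,1,2,1,2,1,3,2], [1,2,3,1,2,1,3,2,1],
     [1,2,3,1,2,1,2,1,3,2,1], [2,1,2,3,1,2,1,2,1,3,2,1,2]]"

lemma length_refl_words [simp]: "length refl_words = 15"
  by (simp add: refl_words_def)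

lemma refl_words_lists: "k < 15 \<Longrightarrow> refl_words ! k \<in> lists {1,2,3}"
  unfolding less_15_iff refl_words_def by (elim insertE emptyE) simp_all

lemma refl_word_conjugate:
  assumes "k < 15"
  obtains u i where "u \<in> lists {1,2,3}" "i \<in> {1,2,3}" "refl_words ! k = u @ [i] @ rev u"
proof -
  let ?w = "refl_words ! k"
  let ?h = "length ?w div 2"
  have "?w = take ?h ?w @ [?w ! ?h] @ rev (take ?h ?w) \<and> ?h < length ?w"
    using assms unfolding less_15_iff refl_words_def by (elim insertE emptyE) simp_all
  moreover from this have "take ?h ?w \<in> lists {1,2,3}" "?w ! ?h \<in> {1,2,3}"
    using refl_words_lists[OF assms] by (auto dest: in_set_takeD simp: in_lists_conv_set)
  ultimately show ?thesis
    using that by blast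
qed

text \<open>The reflection in root \<open>k\<close> sends this root to its negative, so multiplying
  \<open>w\<close> by it on the right reverses the sign of the image of the root.\<close>

lemma nth_fold_refl_word:
  assumes "length v = 15" "k < 15"
  shows "fold step (refl_words ! k) v ! k \<longleftrightarrow> \<not> v ! k"
proof -
  from assms(1) obtain a0 a1 a2 a3 a4 a5 a6 a7 a8 a9 a10 a11 a12 a13 a14
    where v: "v = [a0,a1,a2,a3,a4,a5,a6,a7,a8,a9,a10,a11,a12,a13,a14]"
    by (rule list_15_cases)
  show ?thesis
    using assms(2) unfolding v less_15_iff refl_words_def
    by (elim insertE emptyE) simp_all
qed

lemma distinct_vec_refl_words: "distinct (map vec refl_words)"
  by code_simp

text \<open>
  Minimal representatives \<open>u\<close> of the left cosets of the dihedral subgroup generated by \<open>s\<^sub>1\<close> and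
  \<open>s\<^sub>2\<close>: the products \<open>u v\<close> run through the group.
\<close>

definition coset_words :: "nat list list" where
  "coset_words =
    [[], [3], [2,3], [1,2,3], [2,1,2,3], [1,2,1,2,3], [3,2,1,2,3], [1,3,2,1,2,3],
     [2,1,3,2,1,2,3], [1,2,1,3,2,1,2,3], [2,1,2,1,3,2,1,2,3], [3,2,1,2,1,3,2,1,2,3]]"

definition dihedral_words :: "nat list list" where
  "dihedral_words =
    [[], [1], [2], [1,2], [2,1], [1,2,1], [2,1,2], [1,2,1,2], [2,1,2,1], [1,2,1,2,1]]"

definition vecs :: "bool list list" where
  "vecs = [vec (u @ v). u \<leftarrow> coset_words, v \<leftarrow> dihedral_words]"

definition closed_under_step :: "bool list list \<Rightarrow> bool" where
  "closed_under_step vs = list_all (\<lambda>v. list_all (\<lambda>i. List.member vs (step i v)) [1,2,3]) vs"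

lemma closed_under_step_vecs: "closed_under_step vecs"
  by code_simp

text \<open>The list holds the vector of the empty word, and appending a letter amounts to a
  \<open>step\<close>, which does not leave the list.\<close>

lemma vec_in_vecs: "xs \<in> lists {1,2,3} \<Longrightarrow> vec xs \<in> set vecs"
proof (induction xs rule: rev_induct)
  case Nil
  show ?case
    by (simp add: vecs_def coset_words_def dihedral_words_def)
next
  case (snoc i xs)
  then have "vec xs \<in> set vecs" "i \<in> {1,2,3}"
    by auto
  then have "step i (vec xs) \<in> set vecs"
    using closed_under_step_vecs by (auto simp: closed_under_step_def list_all_iff)
  then show ?case
    by (simp add: vec_def)
qed

lemma length_in_vecs: "v \<in> set vecs \<Longrightarrow> length v = 15"
  by (auto simp: vecs_def)

section \<open>Systems of priv roots\<close>

text \<open>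
  The result lists the sets \<open>T\<close> of private positions, as characteristic vectors, that extend the set
  \<open>C\<close> of positions chosen so far. Here \<open>E\<close> holds the tails of the vectors that vanish on \<open>C\<close>, and each
  member of \<open>Ls\<close> holds those of the vectors that meet \<open>C\<close> exactly in one given position.
\<close>

fun families :: "nat \<Rightarrow> nat \<Rightarrow> bool list list \<Rightarrow> bool list list list \<Rightarrow> bool list list" where
  "families m 0 E Ls = (if length Ls < m then [] else [[]])"
| "families m (Suc n) E Ls =
    (if Suc n + length Ls < m then [] else
       map ((#) False) (families m n (map tl E) (map (map tl) Ls)) @
       (let E1 = map tl (filter hd E);
            Ms = map (\<lambda>L. map tl (filter (\<lambda>v. \<not> hd v) L)) Ls
        in if E1 = [] \<or> list_ex (\<lambda>L. L = []) Ms then []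
           else map ((#) True) (families m n (map tl (filter (\<lambda>v. \<not> hd v) E)) (E1 # Ms))))"

text \<open>Positions are decided from left to right. When the head is chosen, the vectors of
  \<open>E\<close> that contain it become its candidates, and all vectors kept for other positions
  must avoid it. The vectors provided by the hypotheses survive these filters, so no candidate list
  on the branch of \<open>T\<close> becomes empty, and the bound \<open>m\<close> does not cut the
  branch either.\<close>

lemma families_complete:
  assumes "length T = n"
    and "\<And>v. v \<in> set E \<Longrightarrow> length v = n"
    and "\<And>L v. L \<in> set Ls \<Longrightarrow> v \<in> set L \<Longrightarrow> length v = n"
    and "\<And>L. L \<in> set Ls \<Longrightarrow> \<exists>v\<in>set L. \<forall>j<n. T ! j \<longrightarrow> \<not> v ! j"
    and "\<And>i. i < n \<Longrightarrow> T ! i \<Longrightarrow> \<exists>v\<in>set E. v ! i \<and> (\<forall>j<n. T ! j \<and> v ! j \<longrightarrow> j = i)"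
    and "m \<le> length Ls + count_list T True"
  shows "T \<in> set (families m n E Ls)"
  using assms
proof (induction n arbitrary: T E Ls)
  case 0
  then show ?case by simp
next
  case (Suc n)
  obtain t T' where T: "T = t # T'" and T': "length T' = n"
    using Suc.prems(1) by (cases T) auto
  have nonempty: "v = hd v # tl v" if "length v = Suc n" for v :: "bool list"
    using that by (cases v) auto
  have hd: "v ! 0 = hd v" and tl: "v ! Suc j = tl v ! j" if "length v = Suc n"
    for v :: "bool list" and j
    by (subst nonempty[OF that], simp)+
  note E = Suc.prems(2) and Ls = Suc.prems(3)
  have "count_list T True \<le> Suc n"
    using Suc.prems(1) count_le_length[of T True] by simp
  then have enough: "\<not> Suc n + length Ls < m"
    using Suc.prems(6) by simp
  show ?case
  proof (cases t)
    case False
    have "T' \<in> set (families m n (map tl E) (map (map tl) Ls))"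
    proof (rule Suc.IH)
      show "length T' = n" by (rule T')
      show "length v = n" if "v \<in> set (map tl E)" for v
        using that E by fastforce
      show "length v = n" if "L \<in> set (map (map tl) Ls)" "v \<in> set L" for L v
        using that Ls by fastforce
      show "\<exists>v\<in>set L. \<forall>j<n. T' ! j \<longrightarrow> \<not> v ! j" if L: "L \<in> set (map (map tl) Ls)" for L
      proof -
        obtain L' where L': "L' \<in> set Ls" "L = map tl L'"
          using L by auto
        obtain v where v: "v \<in> set L'" "\<forall>j<Suc n. T ! j \<longrightarrow> \<not> v ! j"
          using Suc.prems(4)[OF L'(1)] by blast
        have "T' ! j \<longrightarrow> \<not> tl v ! j" if "j < n" for j
          using v(2) that tl[OF Ls[OF L'(1) v(1)], of j] by (auto simp: T)
        then show ?thesis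
          using L' v(1) by auto
      qed
      show "\<exists>v\<in>set (map tl E). v ! i \<and> (\<forall>j<n. T' ! j \<and> v ! j \<longrightarrow> j = i)"
        if i: "i < n" "T' ! i" for i
      proof -
        obtain v where v: "v \<in> set E" "v ! Suc i" "\<forall>j<Suc n. T ! j \<and> v ! j \<longrightarrow> j = Suc i"
          using Suc.prems(5)[of "Suc i"] i by (auto simp: T)
        have "T' ! j \<and> tl v ! j \<longrightarrow> j = i" if "j < n" for j
          using v(3)[rule_format, of "Suc j"] that tl[OF E[OF v(1)], of j] by (auto simp: T)
        then show ?thesis
          using v tl[OF E[OF v(1)], of i] by auto
      qed
      show "m \<le> length (map (map tl) Ls) + count_list T' True"
        using Suc.prems(6) False by (simp add: T)
    qed
    then show ?thesis
      using enough False by (simp add: T)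
  next
    case True
    let ?E1 = "map tl (filter hd E)"
    let ?Ms = "map (\<lambda>L. map tl (filter (\<lambda>v. \<not> hd v) L)) Ls"
    \<comment> \<open>The vector of \<open>E\<close> that meets \<open>T\<close> in its head only is
      a candidate for the new position.\<close>
    have priv: "\<exists>v\<in>set ?E1. \<forall>j<n. T' ! j \<longrightarrow> \<not> v ! j"
    proof -
      obtain v where v: "v \<in> set E" "v ! 0" "\<forall>j<Suc n. T ! j \<and> v ! j \<longrightarrow> j = 0"
        using Suc.prems(5)[of 0] True by (auto simp: T)
      have "T' ! j \<longrightarrow> \<not> tl v ! j" if "j < n" for j
        using v(3)[rule_format, of "Suc j"] that tl[OF E[OF v(1)], of j] by (auto simp: T)
      then show ?thesis
        using v hd[OF E[OF v(1)]] by auto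
    qed
    have old: "\<exists>v\<in>set L. \<forall>j<n. T' ! j \<longrightarrow> \<not> v ! j" if L: "L \<in> set ?Ms" for L
    proof -
      obtain L' where L': "L' \<in> set Ls" "L = map tl (filter (\<lambda>v. \<not> hd v) L')"
        using L by auto
      obtain v where v: "v \<in> set L'" "\<forall>j<Suc n. T ! j \<longrightarrow> \<not> v ! j"
        using Suc.prems(4)[OF L'(1)] by blast
      have "T' ! j \<longrightarrow> \<not> tl v ! j" if "j < n" for j
        using v(2)[rule_format, of "Suc j"] that tl[OF Ls[OF L'(1) v(1)], of j]
        by (auto simp: T)
      moreover have "\<not> hd v"
        using v(2)[rule_format, of 0] True hd[OF Ls[OF L'(1) v(1)]] by (simp add: T)
      ultimately show ?thesis
        using L' v(1) by auto
    qed
    have "T' \<in> set (families m n (map tl (filter (\<lambda>v. \<not> hd v) E)) (?E1 # ?Ms))"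
    proof (rule Suc.IH)
      show "length T' = n" by (rule T')
      show "length v = n" if "v \<in> set (map tl (filter (\<lambda>v. \<not> hd v) E))" for v
        using that E by fastforce
      show "length v = n" if "L \<in> set (?E1 # ?Ms)" "v \<in> set L" for L v
        using that E Ls by fastforce
      show "\<exists>v\<in>set L. \<forall>j<n. T' ! j \<longrightarrow> \<not> v ! j" if "L \<in> set (?E1 # ?Ms)" for L
        using that priv old by auto
      show "\<exists>v\<in>set (map tl (filter (\<lambda>v. \<not> hd v) E)). v ! i \<and> (\<forall>j<n. T' ! j \<and> v ! j \<longrightarrow> j = i)"
        if i: "i < n" "T' ! i" for i
      proof -
        obtain v where v: "v \<in> set E" "v ! Suc i" "\<forall>j<Suc n. T ! j \<and> v ! j \<longrightarrow> j = Suc i"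
          using Suc.prems(5)[of "Suc i"] i by (auto simp: T)
        have "T' ! j \<and> tl v ! j \<longrightarrow> j = i" if "j < n" for j
          using v(3)[rule_format, of "Suc j"] that tl[OF E[OF v(1)], of j] by (auto simp: T)
        moreover have "\<not> hd v"
          using v(3)[rule_format, of 0] True hd[OF E[OF v(1)]] by (auto simp: T)
        ultimately show ?thesis
          using v tl[OF E[OF v(1)], of i] by auto
      qed
      show "m \<le> length (?E1 # ?Ms) + count_list T' True"
        using Suc.prems(6) True by (simp add: T)
    qed
    moreover have "?E1 \<noteq> []" "\<not> list_ex (\<lambda>L. L = []) ?Ms"
      using priv old unfolding list_ex_iff by fastforce+
    ultimately show ?thesis
      using enough True by (simp add: T Let_def)
  qed
qed

text \<open>A member of a family with private positions \<open>T\<close> meets \<open>T\<close>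
  exactly once, in its own position; the condition on the number of common positions excludes such
  members among the vectors that contain the last position.\<close>

definition highest_missed :: "bool list list \<Rightarrow> bool list list \<Rightarrow> bool" where
  "highest_missed vs Ts =
     list_all (\<lambda>T. list_all (\<lambda>v. \<not> last v \<or> length (filter id (map2 (\<and>) T v)) \<noteq> 1) vs) Ts"

text \<open>
  The search finds the sets \<open>{1,3,5,7,12,13}\<close> and \<open>{4,6,8,9,10,11}\<close>.
\<close>

lemma highest_missed_families: "highest_missed vecs (families 6 15 vecs [])"
  by code_simp

text \<open>If there were six members, a choice of one private position for each would give a set
  \<open>T\<close> that the search must find; but then no member could cover position 14. The map
  \<open>f\<close> will be \<open>inversion_vec\<close>.\<close>

lemma card_private_cover_le_5:
  assumes vecs: "\<And>w. w \<in> Y \<Longrightarrow> f w \<in> set vecs"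
    and cover: "\<And>k. k < 15 \<Longrightarrow> \<exists>w\<in>Y. f w ! k"
    and priv: "\<And>w. w \<in> Y \<Longrightarrow> \<exists>k<15. f w ! k \<and> (\<forall>w'\<in>Y. f w' ! k \<longrightarrow> w' = w)"
  shows "card Y \<le> 5"
proof (rule ccontr)
  assume "\<not> card Y \<le> 5"
  then have card: "6 \<le> card Y" by simp
  obtain t where t: "\<And>w. w \<in> Y \<Longrightarrow> t w < 15 \<and> f w ! t w \<and> (\<forall>w'\<in>Y. f w' ! t w \<longrightarrow> w' = w)"
    using priv by metis
  define T where "T = map (\<lambda>k. k \<in> t ` Y) [0..<15]"
  have T: "length T = 15" "\<And>k. k < 15 \<Longrightarrow> T ! k \<longleftrightarrow> k \<in> t ` Y"
    by (simp_all add: T_def)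
  \<comment> \<open>Every position in \<open>T\<close> is private to the member it was chosen for,
    so a member meets \<open>T\<close> in its own position only.\<close>
  have trace: "{k. k < 15 \<and> T ! k \<and> f w ! k} = {t w}" if "w \<in> Y" for w
  proof (intro equalityI subsetI)
    fix k
    assume "k \<in> {k. k < 15 \<and> T ! k \<and> f w ! k}"
    then obtain w' where "w' \<in> Y" "k = t w'" "f w ! t w'"
      using T(2) by auto
    then show "k \<in> {t w}"
      using t \<open>w \<in> Y\<close> by auto
  qed (use that t T(2) in auto)
  have "inj_on t Y"
    using t by (metis inj_onI)
  then have "card (t ` Y) = card Y"
    by (rule card_image)
  moreover have "count_list T True = card (t ` Y)"
  proof -
    have "{k. k < 15 \<and> k \<in> t ` Y} = t ` Y"
      using t by auto
    then show ?thesis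
      by (simp add: T_def count_list_eq_length_filter length_filter_conv_card filter_map o_def
          del: upt_Suc cong: conj_cong)
  qed
  ultimately have count: "6 \<le> count_list T True"
    using card by simp
  have "T \<in> set (families 6 15 vecs [])"
  proof (rule families_complete)
    show "\<exists>v\<in>set vecs. v ! i \<and> (\<forall>j<15. T ! j \<and> v ! j \<longrightarrow> j = i)" if i: "i < 15" "T ! i" for i
    proof -
      obtain w where w: "w \<in> Y" "i = t w"
        using i T by auto
      then show ?thesis
        using vecs[OF w(1)] trace[OF w(1)] by blast
    qed
  qed (use T count length_in_vecs in auto)
  \<comment> \<open>Completeness supplies a member that inverts the reflection in the highest root,
    contrary to the result of the search.\<close>
  moreover obtain w where w: "w \<in> Y" "f w ! 14"
    using cover[of 14] by auto
  moreover have len: "length (f w) = 15"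
    using length_in_vecs vecs w(1) by blast
  then have "last (f w)"
    using w(2) by (subst last_conv_nth) auto
  ultimately have "length (filter id (map2 (\<and>) T (f w))) \<noteq> 1"
    using highest_missed_families vecs[OF w(1)] by (auto simp: highest_missed_def list_all_iff)
  moreover have "length (filter id (map2 (\<and>) T (f w))) = card {k. k < 15 \<and> T ! k \<and> f w ! k}"
    using T(1) len by (auto simp: length_filter_conv_card intro!: arg_cong[where f = card])
  ultimately show False
    using trace[OF w(1)] by simp
qed

section \<open>A minimal complete family of five elements\<close>

definition witness_words :: "nat list list" where
  "witness_words = [[1,2,3], [1,2,1,3], [1,2,1,3,2], [1,2,1,3,2,1], [1,2,1,3,2,1,2]]"

lemma witness_cover: "list_all (\<lambda>k. list_ex (\<lambda>xs. vec xs ! k) witness_words) [0..<15]"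
  by code_simp

text \<open>The private positions are 7, 9, 11, 13 and 14, in the order of the words.\<close>

lemma witness_private:
  "list_all (\<lambda>xs. list_ex (\<lambda>k. vec xs ! k \<and> list_all (\<lambda>ys. vec ys ! k \<longrightarrow> ys = xs) witness_words)
     [0..<15]) witness_words"
  by code_simp

section \<open>The Coxeter group of type H3\<close>

declare One_nat_def [simp del]

locale H3_system = group W for W :: "('a, 'm) monoid_scheme" (structure) +
  fixes s :: "nat \<Rightarrow> 'a"
  assumes coxeter: "coxeter_system W {1,2,3} s H3_matrix"
begin

definition ev :: "nat list \<Rightarrow> 'a" where
  "ev xs = list_product W (map s xs)"

lemma presentation: "group_presentation W {1,2,3} s (coxeter_relators {1,2,3} H3_matrix)"
  using coxeter by (simp add: coxeter_system_def)

lemma s_closed: "i \<in> {1,2,3} \<Longrightarrow> s i \<in> carrier W"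
  using presentation unfolding group_presentation_def by blast

lemma ev_Nil [simp]: "ev [] = \<one>"
  by (simp add: ev_def list_product_def)

lemma ev_Cons [simp]: "ev (i # xs) = s i \<otimes> ev xs"
  by (simp add: ev_def list_product_def)

lemma ev_closed: "xs \<in> lists {1,2,3} \<Longrightarrow> ev xs \<in> carrier W"
  by (induction xs) (use s_closed in auto)

lemma ev_append:
  "xs \<in> lists {1,2,3} \<Longrightarrow> ys \<in> lists {1,2,3} \<Longrightarrow> ev (xs @ ys) = ev xs \<otimes> ev ys"
  by (induction xs) (use s_closed in \<open>auto simp: ev_closed m_assoc\<close>)

lemma word_value_positive: "word_value W s (map (\<lambda>i. (i, True)) xs) = ev xs"
  by (simp add: word_value_def ev_def letter_value_def o_def)

lemma ev_eq_one_iff: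
  assumes "xs \<in> lists {1,2,3}"
  shows "ev xs = \<one> \<longleftrightarrow>
    pres_eq {1,2,3} (coxeter_relators {1,2,3} H3_matrix) (map (\<lambda>i. (i, True)) xs) []"
proof -
  have "map (\<lambda>i. (i, True)) xs \<in> lists ({1,2,3} \<times> UNIV)"
    using assms by (auto simp: in_lists_conv_set)
  then show ?thesis
    using presentation unfolding group_presentation_def word_value_positive[symmetric] by blast
qed

lemma ev_relator:
  assumes "i \<in> {1,2,3}" "j \<in> {1,2,3}"
  shows "ev (concat (replicate (H3_matrix i j) [i,j])) = \<one>"
proof -
  let ?r = "concat (replicate (H3_matrix i j) [(i, True), (j, True)])"
  have "?r \<in> coxeter_relators {1,2,3} H3_matrix"
    using assms unfolding coxeter_relators_def by blast
  from pres_relator[OF this, of "{1,2,3}" "[]" "[]"]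
  have "pres_eq {1,2,3} (coxeter_relators {1,2,3} H3_matrix) ?r []"
    by simp
  moreover have "?r = map (\<lambda>i. (i, True)) (concat (replicate (H3_matrix i j) [i,j]))"
    by (simp add: map_concat)
  moreover have "concat (replicate n [i,j]) \<in> lists {1,2,3}" for n
    using assms by (induction n) auto
  ultimately show ?thesis
    by (simp add: ev_eq_one_iff)
qed

lemma s_square: "i \<in> {1,2,3} \<Longrightarrow> s i \<otimes> s i = \<one>"
  using ev_relator[of i i] s_closed[of i] by (simp add: H3_matrix_def replicate_Suc[of 0, folded One_nat_def])

lemma inv_s: "i \<in> {1,2,3} \<Longrightarrow> inv (s i) = s i"
  using s_square s_closed by (intro inv_equality) auto

lemma ev_rev: "xs \<in> lists {1,2,3} \<Longrightarrow> ev (rev xs) = inv (ev xs)"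
proof (induction xs)
  case (Cons i xs)
  then have "i \<in> {1,2,3}" "xs \<in> lists {1,2,3}"
    by auto
  then show ?case
    using Cons.IH ev_append[of "rev xs" "[i]"] s_closed
    by (simp add: inv_mult_group ev_closed inv_s in_lists_conv_set)
qed simp

text \<open>Turns a relator of the form \<open>xs @ rev ys\<close> into an equation between two
  words; the braid relations arise in this way.\<close>

lemma ev_cong:
  assumes "xs \<in> lists {1,2,3}" "ys \<in> lists {1,2,3}" "ev (xs @ rev ys) = \<one>"
  shows "ev xs = ev ys"
proof -
  have "ev xs \<otimes> inv (ev ys) = \<one>"
    using assms by (simp add: ev_append ev_rev in_lists_conv_set)
  then show ?thesis
    using assms(1,2) ev_closed inv_equality inv_inv by (metis inv_closed)
qed

text \<open>A word with value one is trivial modulo the relators by the presentation, hence acts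
  trivially by \<open>step\<close>. So the vector of a word depends only on the group
  element.\<close>

lemma vec_cong:
  assumes "xs \<in> lists {1,2,3}" "ys \<in> lists {1,2,3}" "ev xs = ev ys"
  shows "vec xs = vec ys"
proof -
  have "ev (xs @ rev ys) = \<one>"
    using assms by (simp add: ev_append ev_rev ev_closed in_lists_conv_set)
  then have "fold step (xs @ rev ys) v = v" for v
    using fold_step_pres_eq[of "map (\<lambda>i. (i, True)) (xs @ rev ys)" "[]" v] assms
    by (subst (asm) ev_eq_one_iff) (auto simp: o_def in_lists_conv_set)
  then have "fold step ys (fold step (rev ys) (vec xs)) = fold step ys (replicate 15 False)"
    by (simp add: vec_def)
  then show ?thesis
    by (simp add: fold_step_rev vec_def)
qed

lemma ev_surj:
  assumes "w \<in> carrier W"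
  obtains xs where "xs \<in> lists {1,2,3}" "ev xs = w"
proof -
  have "w \<in> generate W (s ` {1,2,3})"
    using assms presentation unfolding group_presentation_def by blast
  then have "\<exists>xs\<in>lists {1,2,3}. ev xs = w"
  proof induction
    case one
    then show ?case by (intro bexI[of _ "[]"]) auto
  next
    case (incl h)
    then obtain i where "i \<in> {1,2,3}" "h = s i" by blast
    then show ?case using s_closed by (intro bexI[of _ "[i]"]) auto
  next
    case (inv h)
    then obtain i where "i \<in> {1,2,3}" "h = s i" by blast
    then show ?case using s_closed inv_s by (intro bexI[of _ "[i]"]) auto
  next
    case (eng h1 h2)
    then obtain xs ys where "xs \<in> lists {1,2,3}" "ev xs = h1" "ys \<in> lists {1,2,3}" "ev ys = h2"
      by blast
    then show ?case using ev_append by (intro bexI[of _ "xs @ ys"]) auto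
  qed
  then show ?thesis using that by blast
qed

abbreviation len :: "'a \<Rightarrow> nat" where
  "len \<equiv> cox_length W (s ` {1,2,3})"

lemma len_le: "xs \<in> lists {1,2,3} \<Longrightarrow> len (ev xs) \<le> length xs"
  unfolding cox_length_def
  by (intro Least_le bexI[of _ "map s xs"]) (auto simp: ev_def)

lemma reduced_word:
  assumes "w \<in> carrier W"
  obtains xs where "xs \<in> lists {1,2,3}" "ev xs = w" "length xs = len w"
proof -
  let ?P = "\<lambda>n. \<exists>xs\<in>lists (s ` {1,2,3}). length xs = n \<and> list_product W xs = w"
  obtain ys where ys: "ys \<in> lists {1,2,3}" "ev ys = w"
    using ev_surj assms by blast
  then have "?P (length ys)"
    by (intro bexI[of _ "map s ys"]) (auto simp: ev_def)
  then have "?P (len w)"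
    unfolding cox_length_def by (rule LeastI)
  then obtain zs where "zs \<in> lists (s ` {1,2,3})" "length zs = len w" "list_product W zs = w"
    by blast
  moreover from this obtain xs where "xs \<in> lists {1,2,3}" "zs = map s xs"
    unfolding lists_image by blast
  ultimately show ?thesis
    using that by (simp add: ev_def)
qed

subsection \<open>Reflections\<close>

definition r :: "nat \<Rightarrow> 'a" where
  "r k = ev (refl_words ! k)"

definition conj :: "nat \<Rightarrow> 'a \<Rightarrow> 'a" where
  "conj i x = s i \<otimes> (x \<otimes> s i)"

lemma r_closed: "k < 15 \<Longrightarrow> r k \<in> carrier W"
  by (simp add: r_def ev_closed refl_words_lists)

text \<open>Applying \<open>conj\<close> along a word is conjugation by its value, so relations
  between the generators pass to the maps \<open>conj i\<close>.\<close>

lemma fold_conj: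
  "xs \<in> lists {1,2,3} \<Longrightarrow> x \<in> carrier W \<Longrightarrow> foldr conj xs x = ev xs \<otimes> (x \<otimes> ev (rev xs))"
proof (induction xs)
  case (Cons i xs)
  then have i: "i \<in> {1,2,3}" and xs: "xs \<in> lists {1,2,3}" by auto
  then have "ev (rev (i # xs)) = ev (rev xs) \<otimes> s i"
    using ev_append[of "rev xs" "[i]"] s_closed by (simp add: in_lists_conv_set)
  then show ?case
    using Cons i xs s_closed[OF i] ev_closed[of xs] ev_closed[of "rev xs"]
    by (simp add: conj_def m_assoc in_lists_conv_set)
qed simp

lemma conj_conj: "i \<in> {1,2,3} \<Longrightarrow> x \<in> carrier W \<Longrightarrow> conj i (conj i x) = x"
  using fold_conj[of "[i,i]" x] s_closed[of i] s_square[of i] by simp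

lemma foldr_conj_cong:
  assumes "xs \<in> lists {1,2,3}" "ys \<in> lists {1,2,3}" "ev (xs @ rev ys) = \<one>" "x \<in> carrier W"
  shows "foldr conj xs x = foldr conj ys x"
  using ev_cong[OF assms(1-3)] assms by (simp add: fold_conj ev_rev)

lemma H3_matrix_simps:
  "H3_matrix 1 2 = 5" "H3_matrix 1 3 = 2" "H3_matrix 2 1 = 5" "H3_matrix 3 1 = 2" "H3_matrix 2 3 = 3"
  by (simp_all add: H3_matrix_def doubleton_eq_iff)

lemma concat_replicate_numeral:
  "concat (replicate 2 xs) = xs @ xs" "concat (replicate 3 xs) = xs @ xs @ xs"
  "concat (replicate 5 xs) = xs @ xs @ xs @ xs @ xs"
  by (simp_all add: numeral_eq_Suc)

lemma conj_1_3: "x \<in> carrier W \<Longrightarrow> conj 1 (conj 3 x) = conj 3 (conj 1 x)"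
  using foldr_conj_cong[of "[1,3]" "[3,1]" x] ev_relator[of 1 3]
  by (simp add: H3_matrix_simps concat_replicate_numeral)

lemma conj_2_3: "x \<in> carrier W \<Longrightarrow> conj 2 (conj 3 (conj 2 x)) = conj 3 (conj 2 (conj 3 x))"
  using foldr_conj_cong[of "[2,3,2]" "[3,2,3]" x] ev_relator[of 2 3]
  by (simp add: H3_matrix_simps concat_replicate_numeral)

lemma conj_1_2:
  "x \<in> carrier W \<Longrightarrow>
    conj 1 (conj 2 (conj 1 (conj 2 (conj 1 x)))) = conj 2 (conj 1 (conj 2 (conj 1 (conj 2 x))))"
  using foldr_conj_cong[of "[1,2,1,2,1]" "[2,1,2,1,2]" x] ev_relator[of 1 2]
  by (simp add: H3_matrix_simps concat_replicate_numeral)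

text \<open>These equations form a forest rooted at the simple reflections; \<open>conj_r\<close>
  completes it to the whole conjugation action.\<close>

lemma r_conj:
  "r 0 = s 1" "r 1 = s 2" "r 2 = s 3"
  "r 3 = conj 2 (r 0)" "r 4 = conj 1 (r 1)" "r 5 = conj 3 (r 1)" "r 6 = conj 1 (r 3)"
  "r 7 = conj 3 (r 3)" "r 8 = conj 3 (r 4)" "r 9 = conj 3 (r 6)" "r 10 = conj 2 (r 8)"
  "r 11 = conj 2 (r 9)" "r 12 = conj 1 (r 10)" "r 13 = conj 1 (r 11)" "r 14 = conj 2 (r 13)"
  using s_closed[of 1] s_closed[of 2] s_closed[of 3]
  by (simp_all add: r_def refl_words_def conj_def m_assoc)

lemma conj_self: "i \<in> {1,2,3} \<Longrightarrow> conj i (s i) = s i"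
  using s_square s_closed by (simp add: conj_def)

lemma conj_1_s3: "conj 1 (s 3) = s 3"
  using ev_cong[of "[1,3,1]" "[3]"] ev_relator[of 1 3] s_closed[of 1] s_closed[of 3]
  by (simp add: H3_matrix_simps concat_replicate_numeral conj_def)

lemma conj_3_s1: "conj 3 (s 1) = s 1"
  using ev_cong[of "[3,1,3]" "[1]"] ev_relator[of 3 1] s_closed[of 1] s_closed[of 3]
  by (simp add: H3_matrix_simps concat_replicate_numeral conj_def)

lemma conj_2_s3: "conj 2 (s 3) = conj 3 (s 2)"
  using ev_cong[of "[2,3,2]" "[3,2,3]"] ev_relator[of 2 3] s_closed[of 2] s_closed[of 3]
  by (simp add: H3_matrix_simps concat_replicate_numeral conj_def)

lemma conj_r:
  assumes "i \<in> {1,2,3}" "k < 15"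
  shows "conj i (r k) = r (root_perm i ! k)"
proof -
  \<comment> \<open>A braid relation between the maps \<^term>\<open>conj i\<close>, applied to a reflection whose two orbits are
    known up to the last step, gives that last step.\<close>
  note up = r_conj(4-15)[symmetric]
  have flip: "conj i (r k) = r j" if "conj i (r j) = r k" "i \<in> {1,2,3}" "j < 15" for i j k
    using conj_conj[OF that(2) r_closed[OF that(3)]] that(1) by simp
  have down: "conj 2 (r 3) = r 0"
    "conj 1 (r 4) = r 1"
    "conj 3 (r 5) = r 1"
    "conj 1 (r 6) = r 3"
    "conj 3 (r 7) = r 3"
    "conj 3 (r 8) = r 4"
    "conj 3 (r 9) = r 6"
    "conj 2 (r 10) = r 8"
    "conj 2 (r 11) = r 9"
    "conj 1 (r 12) = r 10"
    "conj 1 (r 13) = r 11"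
    "conj 2 (r 14) = r 13"
    by (rule flip, simp_all add: up)+
  have simple: "conj 1 (r 0) = r 0" "conj 2 (r 1) = r 1" "conj 3 (r 2) = r 2"
    "conj 1 (r 2) = r 2" "conj 3 (r 0) = r 0" "conj 2 (r 2) = r 5"
    using conj_self conj_1_s3 conj_3_s1 conj_2_s3 by (simp_all add: r_conj(1-3,6))
  \<comment> \<open>Both sides are the longest element of the dihedral subgroup generated by
    \<open>s 1\<close> and \<open>s 2\<close>, in its two reduced forms.\<close>
  have b4: "conj 2 (r 4) = r 6"
    using ev_cong[of "[2,1,2,1,2]" "[1,2,1,2,1]"] ev_relator[of 2 1] s_closed[of 1] s_closed[of 2]
    by (simp add: H3_matrix_simps concat_replicate_numeral conj_def r_def refl_words_def m_assoc)
  note known = up down simple b4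
  have a5: "conj 1 (r 5) = r 8"
    using conj_1_3[of "r 1"] r_closed by (simp add: known)
  have a7: "conj 1 (r 7) = r 9"
    using conj_1_3[of "r 3"] r_closed by (simp add: known)
  have c10: "conj 3 (r 10) = r 11"
    using conj_2_3[of "r 4"] r_closed by (simp add: known)
  have c12: "conj 3 (r 12) = r 13"
    using conj_1_3[of "r 10"] r_closed by (simp add: known c10)
  have b7: "conj 2 (r 7) = r 7"
    using conj_2_3[of "r 0"] r_closed by (simp add: known)
  have b12: "conj 2 (r 12) = r 12"
    using conj_1_2[of "r 2"] r_closed by (simp add: known a5)
  have a14: "conj 1 (r 14) = r 14"
    using conj_1_2[of "r 7"] r_closed by (simp add: known a7 b7)
  have c14: "conj 3 (r 14) = r 14"
    using conj_2_3[of "r 12"] r_closed by (simp add: known c12 b12)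
  have nontree: "conj 2 (r 5) = r 2" "conj 2 (r 6) = r 4" "conj 1 (r 8) = r 5"
    "conj 1 (r 9) = r 7" "conj 3 (r 11) = r 10" "conj 3 (r 13) = r 12"
    by (rule flip, simp_all add: simple b4 a5 a7 c10 c12)+
  show ?thesis
    using assms unfolding less_15_iff root_perm_def
    by (elim insertE emptyE) (simp_all add: known a5 a7 c10 c12 b7 b12 a14 c14 nontree)
qed

lemma r_mult_s:
  assumes "i \<in> {1,2,3}" "k < 15"
  shows "s i \<otimes> r k = r (root_perm i ! k) \<otimes> s i"
proof -
  have "conj i (r k) \<otimes> s i = s i \<otimes> r k"
    using s_closed[OF assms(1)] r_closed[OF assms(2)] s_square[OF assms(1)]
    by (simp add: conj_def m_assoc)
  then show ?thesis
    by (simp add: conj_r[OF assms])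
qed

text \<open>The elements \<open>r k\<close> include the generators and are permuted by every
  \<open>conj i\<close>, so they contain all conjugates of generators. Conversely, a palindrome is a
  conjugate of its middle letter.\<close>

lemma reflections_eq: "reflections W (s ` {1,2,3}) = r ` {..<15}"
proof (intro equalityI subsetI)
  fix x
  assume "x \<in> reflections W (s ` {1,2,3})"
  then obtain w i where w: "w \<in> carrier W" and i: "i \<in> {1,2,3}" and x: "x = w \<otimes> s i \<otimes> inv w"
    unfolding reflections_def by blast
  obtain xs where xs: "xs \<in> lists {1,2,3}" "ev xs = w"
    using ev_surj w by blast
  have "foldr conj ys (s i) \<in> r ` {..<15}" if "ys \<in> lists {1,2,3}" for ys
    using that
  proof (induction ys)
    case Nil
    have "s i \<in> {r 0, r 1, r 2}"
      using i r_conj(1-3) by auto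
    then show ?case by auto
  next
    case (Cons j ys)
    then obtain k where "k < 15" "foldr conj ys (s i) = r k" "j \<in> {1,2,3}"
      by auto
    then show ?case
      using conj_r root_perm_less by auto
  qed
  moreover have "foldr conj xs (s i) = x"
    using xs i w s_closed by (simp add: fold_conj ev_rev x m_assoc)
  ultimately show "x \<in> r ` {..<15}"
    using xs(1) by blast
next
  fix x
  assume "x \<in> r ` {..<15}"
  then obtain k where k: "k < 15" "x = r k" by auto
  then obtain u i where u: "u \<in> lists {1,2,3}" "i \<in> {1,2,3}" "refl_words ! k = u @ [i] @ rev u"
    using refl_word_conjugate by blast
  then have "x = ev u \<otimes> (s i \<otimes> ev (rev u))"
    using k(2) by (simp add: r_def ev_append in_lists_conv_set)
  then have "x = ev u \<otimes> s i \<otimes> inv (ev u)"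
    using u s_closed ev_closed[of u] by (simp add: ev_rev m_assoc)
  then show "x \<in> reflections W (s ` {1,2,3})"
    unfolding reflections_def using u ev_closed by blast
qed

text \<open>Equal group elements have equal vectors, and the fifteen vectors of the palindromes are
  distinct.\<close>

lemma inj_on_r: "inj_on r {..<15}"
proof (rule inj_onI)
  fix j k :: nat
  assume jk: "j \<in> {..<15}" "k \<in> {..<15}" "r j = r k"
  then have "vec (refl_words ! j) = vec (refl_words ! k)"
    using refl_words_lists by (intro vec_cong) (auto simp: r_def)
  then have "map vec refl_words ! j = map vec refl_words ! k"
    using jk by simp
  then show "j = k"
    using jk by (subst (asm) nth_eq_iff_index_eq[OF distinct_vec_refl_words]) auto
qed

text \<open>A palindrome in involutions is its own inverse.\<close>

lemma r_square: "k < 15 \<Longrightarrow> r k \<otimes> r k = \<one>"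
proof -
  assume k: "k < 15"
  then obtain u i where "refl_words ! k = u @ [i] @ rev u"
    using refl_word_conjugate by blast
  then have "rev (refl_words ! k) = refl_words ! k"
    by simp
  then have "inv (r k) = r k"
    unfolding r_def using ev_rev[OF refl_words_lists[OF k]] by simp
  then show ?thesis
    using r_inv[OF r_closed[OF k]] by simp
qed

section \<open>Inversion vectors and length, by a strong exchange argument\<close>

lemma shorter_of_vec:
  assumes "xs \<in> lists {1,2,3}" "k < 15" "vec xs ! k"
  shows "\<exists>ys\<in>lists {1,2,3}. length ys < length xs \<and> ev ys = ev xs \<otimes> r k"
  using assms
proof (induction xs arbitrary: k rule: rev_induct)
  case Nil
  then show ?case by (simp add: vec_def)
next
  case (snoc i xs)
  then have i: "i \<in> {1,2,3}" and xs: "xs \<in> lists {1,2,3}" by auto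
  note closed = s_closed[OF i] ev_closed[OF xs] r_closed[OF snoc.prems(2)]
  have ev: "ev (xs @ [i]) = ev xs \<otimes> s i"
    using i xs s_closed by (simp add: ev_append)
  have nth: "vec (xs @ [i]) ! k \<longleftrightarrow>
      (if k = i - 1 then \<not> vec xs ! k else vec xs ! (root_perm i ! k))"
    using nth_step[OF length_vec snoc.prems(2) i, of xs] by (simp add: vec_def)
  show ?case
  proof (cases "k = i - 1")
    case True
    \<comment> \<open>Root \<open>k\<close> is the simple root of the last letter, so multiplying by
      \<open>r k\<close> deletes that letter.\<close>
    then have "r k = s i"
      using i r_conj(1-3) by (auto simp: One_nat_def)
    then have "ev xs = ev (xs @ [i]) \<otimes> r k"
      using closed s_square[OF i] by (simp add: ev m_assoc)
    then show ?thesis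
      using xs by auto
  next
    case False
    \<comment> \<open>Otherwise the prefix \<open>xs\<close> inverts the image of root
      \<open>k\<close> under the last letter; the prefix is shortened by induction and the letter is
      moved past the reflection with \<open>r_mult_s\<close>.\<close>
    then have "vec xs ! (root_perm i ! k)"
      using nth snoc.prems(3) by simp
    then obtain ys where ys: "ys \<in> lists {1,2,3}" "length ys < length xs"
        "ev ys = ev xs \<otimes> r (root_perm i ! k)"
      using snoc.IH xs root_perm_less snoc.prems(2) by blast
    have "ev (ys @ [i]) = ev xs \<otimes> r (root_perm i ! k) \<otimes> s i"
      using ys i s_closed by (simp add: ev_append)
    also have "\<dots> = ev xs \<otimes> (s i \<otimes> r k)"
      using closed r_closed[OF root_perm_less[OF snoc.prems(2)]] r_mult_s[OF i snoc.prems(2)]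
      by (simp add: m_assoc)
    also have "\<dots> = ev (xs @ [i]) \<otimes> r k"
      using closed by (simp add: ev m_assoc)
    finally show ?thesis
      using ys(1,2) i by (intro bexI[of _ "ys @ [i]"]) auto
  qed
qed

text \<open>Any word for \<open>w\<close> may be chosen, by \<open>vec_cong\<close>.\<close>

definition inversion_vec :: "'a \<Rightarrow> bool list" where
  "inversion_vec w = vec (SOME xs. xs \<in> lists {1,2,3} \<and> ev xs = w)"

lemma inversion_vec_ev:
  assumes "xs \<in> lists {1,2,3}"
  shows "inversion_vec (ev xs) = vec xs"
proof -
  let ?P = "\<lambda>ys. ys \<in> lists {1,2,3} \<and> ev ys = ev xs"
  have "?P (SOME ys. ?P ys)"
    by (rule someI[of ?P xs]) (simp add: assms)
  then show ?thesis
    unfolding inversion_vec_def using vec_cong assms by blast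
qed

lemma inversion_vec_shorter:
  assumes "w \<in> carrier W" "k < 15" "inversion_vec w ! k"
  shows "len (w \<otimes> r k) < len w"
proof -
  \<comment> \<open>The exchange argument holds for every word; a reduced one turns it into a
    statement about length.\<close>
  obtain xs where xs: "xs \<in> lists {1,2,3}" "ev xs = w" "length xs = len w"
    using reduced_word assms(1) by blast
  then obtain ys where "ys \<in> lists {1,2,3}" "length ys < length xs" "ev ys = w \<otimes> r k"
    using shorter_of_vec assms(2,3) inversion_vec_ev by metis
  then show ?thesis
    using len_le xs(3) by fastforce
qed

lemma inversion_vec_mult_r:
  assumes "w \<in> carrier W" "k < 15"
  shows "inversion_vec (w \<otimes> r k) ! k \<longleftrightarrow> \<not> inversion_vec w ! k"
proof -
  obtain xs where xs: "xs \<in> lists {1,2,3}" "ev xs = w"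
    using ev_surj assms(1) by blast
  then have "inversion_vec (w \<otimes> r k) = vec (xs @ refl_words ! k)"
    using inversion_vec_ev[of "xs @ refl_words ! k"] refl_words_lists[OF assms(2)]
    by (simp add: ev_append r_def)
  also have "\<dots> = fold step (refl_words ! k) (vec xs)"
    by (simp add: vec_def)
  finally show ?thesis
    using nth_fold_refl_word[OF length_vec assms(2)] inversion_vec_ev[OF xs(1)] xs(2) by simp
qed

text \<open>If \<open>w\<close> does not invert root \<open>k\<close>, then
  \<open>w \<otimes> r k\<close> does, and multiplying that by \<open>r k\<close> leads back to
  \<open>w\<close>, which is therefore the shorter one.\<close>

lemma shorter_iff_inversion_vec:
  assumes "w \<in> carrier W" "k < 15"
  shows "len (w \<otimes> r k) < len w \<longleftrightarrow> inversion_vec w ! k"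
proof
  assume less: "len (w \<otimes> r k) < len w"
  show "inversion_vec w ! k"
  proof (rule ccontr)
    assume "\<not> inversion_vec w ! k"
    then have "len (w \<otimes> r k \<otimes> r k) < len (w \<otimes> r k)"
      using inversion_vec_mult_r assms r_closed by (intro inversion_vec_shorter) auto
    then show False
      using less assms r_closed r_square by (simp add: m_assoc)
  qed
qed (use inversion_vec_shorter assms in blast)

lemma inversions_eq:
  assumes "w \<in> carrier W"
  shows "inversions W (s ` {1,2,3}) w = r ` {k. k < 15 \<and> inversion_vec w ! k}"
  using shorter_iff_inversion_vec[OF assms] unfolding inversions_def reflections_eq by auto

section \<open>Completeness and minimality in terms of inversion vectors\<close>

lemma inversion_complete_iff:
  "inversion_complete W (s ` {1,2,3}) Y \<longleftrightarrow>
    Y \<subseteq> carrier W \<and> (\<forall>k<15. \<exists>w\<in>Y. inversion_vec w ! k)"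
proof (cases "Y \<subseteq> carrier W")
  case True
  then have "(\<Union>w\<in>Y. inversions W (s ` {1,2,3}) w) =
      r ` {k. k < 15 \<and> (\<exists>w\<in>Y. inversion_vec w ! k)}"
    using inversions_eq by blast
  also have "\<dots> = r ` {..<15} \<longleftrightarrow> {k. k < 15 \<and> (\<exists>w\<in>Y. inversion_vec w ! k)} = {..<15}"
    by (intro inj_on_image_eq_iff[OF inj_on_r]) auto
  finally show ?thesis
    using True unfolding inversion_complete_def reflections_eq by auto
qed (simp add: inversion_complete_def)

text \<open>Removing \<open>w\<close> from a minimal set leaves some reflection uncovered, and this
  one is private to \<open>w\<close>. Conversely, a proper subset misses the private reflection of
  any element that it omits.\<close>

lemma minimal_inversion_complete_iff:
  "minimal_inversion_complete W (s ` {1,2,3}) Y \<longleftrightarrow>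
    Y \<subseteq> carrier W \<and> (\<forall>k<15. \<exists>w\<in>Y. inversion_vec w ! k) \<and>
    (\<forall>w\<in>Y. \<exists>k<15. inversion_vec w ! k \<and> (\<forall>w'\<in>Y. inversion_vec w' ! k \<longrightarrow> w' = w))"
  (is "?L \<longleftrightarrow> ?R")
proof
  assume L: ?L
  then have Y: "Y \<subseteq> carrier W" "\<forall>k<15. \<exists>w\<in>Y. inversion_vec w ! k"
    unfolding minimal_inversion_complete_def inversion_complete_iff by auto
  have "\<exists>k<15. inversion_vec w ! k \<and> (\<forall>w'\<in>Y. inversion_vec w' ! k \<longrightarrow> w' = w)"
    if w: "w \<in> Y" for w
  proof -
    have "\<not> inversion_complete W (s ` {1,2,3}) (Y - {w})"
      using L w unfolding minimal_inversion_complete_def by blast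
    then obtain k where "k < 15" "\<forall>w'\<in>Y - {w}. \<not> inversion_vec w' ! k"
      using Y(1) unfolding inversion_complete_iff by blast
    then show ?thesis
      using Y(2) by blast
  qed
  then show ?R
    using Y by blast
next
  assume R: ?R
  have "\<not> inversion_complete W (s ` {1,2,3}) Z" if "Z \<subset> Y" for Z
  proof -
    obtain w where w: "w \<in> Y" "w \<notin> Z"
      using \<open>Z \<subset> Y\<close> by blast
    then obtain k where "k < 15" "\<forall>w'\<in>Y. inversion_vec w' ! k \<longrightarrow> w' = w"
      using R by blast
    then have "\<not> (\<exists>w'\<in>Z. inversion_vec w' ! k)"
      using w \<open>Z \<subset> Y\<close> by blast
    then show ?thesis
      using \<open>k < 15\<close> unfolding inversion_complete_iff by blast
  qed
  then show ?L
    using R unfolding minimal_inversion_complete_def inversion_complete_iff by blast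
qed

lemma card_minimal_inversion_complete_le_5:
  assumes "minimal_inversion_complete W (s ` {1,2,3}) Y"
  shows "card Y \<le> 5"
proof (rule card_private_cover_le_5[where f = inversion_vec])
  show "inversion_vec w \<in> set vecs" if w: "w \<in> Y" for w
  proof -
    have "w \<in> carrier W"
      using assms w unfolding minimal_inversion_complete_iff by blast
    then show ?thesis
      using inversion_vec_ev vec_in_vecs by (metis ev_surj)
  qed
qed (use assms in \<open>unfold minimal_inversion_complete_iff, blast+\<close>)

lemma minimal_inversion_complete_5:
  "\<exists>Y. minimal_inversion_complete W (s ` {1,2,3}) Y \<and> card Y = 5"
proof -
  have witness: "set witness_words \<subseteq> lists {1,2,3}"
    by (simp add: witness_words_def)
  let ?Y = "ev ` set witness_words"
  have vec: "inversion_vec (ev xs) = vec xs" if "xs \<in> set witness_words" for xs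
    using that witness inversion_vec_ev by blast
  have cover: "\<exists>xs\<in>set witness_words. vec xs ! k" if "k < 15" for k
    using witness_cover that by (simp add: list_all_iff list_ex_iff)
  have priv: "\<exists>k<15. vec xs ! k \<and> (\<forall>ys\<in>set witness_words. vec ys ! k \<longrightarrow> ys = xs)"
    if "xs \<in> set witness_words" for xs
    using bspec[OF witness_private[unfolded list_all_iff list_ex_iff] that] by auto
  have "minimal_inversion_complete W (s ` {1,2,3}) ?Y"
    unfolding minimal_inversion_complete_iff
  proof (intro conjI ballI allI impI)
    show "?Y \<subseteq> carrier W"
      using witness ev_closed by blast
    show "\<exists>w\<in>?Y. inversion_vec w ! k" if "k < 15" for k
      using cover[OF that] vec by (metis imageI)
    show "\<exists>k<15. inversion_vec w ! k \<and> (\<forall>w'\<in>?Y. inversion_vec w' ! k \<longrightarrow> w' = w)"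
      if "w \<in> ?Y" for w
    proof -
      obtain xs where xs: "xs \<in> set witness_words" "w = ev xs"
        using \<open>w \<in> ?Y\<close> by blast
      obtain k where k: "k < 15" "vec xs ! k" "\<forall>ys\<in>set witness_words. vec ys ! k \<longrightarrow> ys = xs"
        using priv[OF xs(1)] by blast
      have "w' = w" if "w' \<in> ?Y" "inversion_vec w' ! k" for w'
        using that k(3) vec xs(2) by (metis imageE)
      then show ?thesis
        using k(1,2) vec[OF xs(1)] xs(2) by metis
    qed
  qed
  \<comment> \<open>Two words with the same value have the same vector, so a private position of one
    belongs to both and forces them to coincide.\<close>
  moreover have "inj_on ev (set witness_words)"
  proof (rule inj_onI)
    fix xs ys
    assume *: "xs \<in> set witness_words" "ys \<in> set witness_words" "ev xs = ev ys"
    then have "vec xs = vec ys"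
      using vec by metis
    then show "xs = ys"
      using priv[OF *(2)] *(1) by metis
  qed
  then have "card ?Y = card (set witness_words)"
    by (rule card_image)
  then have "card ?Y = 5"
    by (simp add: witness_words_def)
  ultimately show ?thesis
    by blast
qed

end

theorem mainTheorem7:
  fixes W :: "('a, 'm) monoid_scheme" and s :: "nat \<Rightarrow> 'a"
  assumes "coxeter_system W {1, 2, 3} s H3_matrix"
  shows "MC W (s ` {1, 2, 3}) = 5"
proof -
  have "group W"
    using assms by (simp add: coxeter_system_def group_presentation_def)
  then interpret H3_system W s
    using assms by (simp add: H3_system_def H3_system_axioms_def)
  let ?M = "{Y. minimal_inversion_complete W (s ` {1,2,3}) Y}"
  have "card ` ?M \<subseteq> {..5}"
    using card_minimal_inversion_complete_le_5 by auto
  \<comment> \<open>The bound also gives the finiteness that \<open>Max\<close> requires.\<close>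
  moreover from this have "finite (card ` ?M)"
    by (rule finite_subset) simp
  moreover have "5 \<in> card ` ?M"
    using minimal_inversion_complete_5 by force
  ultimately show ?thesis
    unfolding MC_def by (intro Max_eqI) auto
qed

end
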